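(* Let $(X,T)$ be a dynamical system. Then the following conditions are equivalent: (1) $(X,T)$ is $\Delta$-transitive; (2) $T$ is surjective and for every $d\ge1$ there exists a point $x\in X$ such that the diagonal $d$-tuple $(x,x,\dots,x)$ is transitive under the action $T\times T^2\times\cdots\times T^d$; (3) for every $d\ge2$ and all non-empty open subsets $U_1,U_2,\dots,U_d$ of $X$, $N(U_1,U_2,\dots,U_d)\neq\emptyset$.
   Context: A dynamical system $(X,T)$ is a compact metric space with a continuous map $T\colon X\to X$. $\mathbb{N}$ is the set of positive integers and $\mathbb{Z}_+$ the set of non-negative integers. The diagonal $d$-tuple $(x,\dots,x)$ is transitive under $T\times T^2\times\cdots\times T^d$ if its orbit $\{(T^nx,T^{2n}x,\dots,T^{dn}x)\colon n\in\mathbb{Z}_+\}$ is dense in $X^d$. $(X,T)$ is $\Delta$-transitive if for every $d\ge2$ there is a residual subset $X_0$ of $X$ such that for every $x\in X_0$ the diagonal $d$-tuple $(x,\dots,x)$ is transitive under $T\times T^2\times\cdots\times T^d$. For subsets $U_1,\dots,U_d$ of $X$ ($d\ge2$), $N(U_1,\dots,U_d)=\{n\in\mathbb{N}\colon\bigcap_{i=1}^d T^{-(i-1)n}U_i\neq\emptyset\}$. *)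

theory Defs
  imports "HOL-Analysis.Analysis"
begin

text \<open>The phase space \<open>X\<close> is the universe of a type \<open>'a\<close> of class \<open>metric_space\<close>; it is nonempty
  because every type is. Without this convention the equivalence fails: on the empty space
  Delta-transitivity and the condition on hitting time sets hold vacuously, but there is no
  point \<open>x\<close> to be transitive.\<close>

definition dynamical_system :: "('a::metric_space \<Rightarrow> 'a) \<Rightarrow> bool" where
  "dynamical_system T \<longleftrightarrow> compact (UNIV :: 'a set) \<and> continuous_on UNIV T"

definition residual :: "'a::topological_space set \<Rightarrow> bool" where
  "residual A \<longleftrightarrow>
    (\<exists>\<G>. countable \<G> \<and> (\<forall>G\<in>\<G>. open G \<and> closure G = UNIV) \<and> \<Inter>\<G> \<subseteq> A)"

text \<open>A point of \<open>X\<^sup>d\<close> is an extensional function on the index set \<open>{1..d}\<close>.\<close>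

abbreviation power_space :: "nat \<Rightarrow> (nat \<Rightarrow> 'a::topological_space) topology" where
  "power_space d \<equiv> product_topology (\<lambda>_. euclidean) {1..d}"

definition diag_orbit :: "('a \<Rightarrow> 'a) \<Rightarrow> nat \<Rightarrow> 'a \<Rightarrow> (nat \<Rightarrow> 'a) set" where
  "diag_orbit T d x = {(\<lambda>i\<in>{1..d}. (T ^^ (i * n)) x) |n. n \<in> (UNIV :: nat set)}"

definition diag_transitive_point ::
    "('a::topological_space \<Rightarrow> 'a) \<Rightarrow> nat \<Rightarrow> 'a \<Rightarrow> bool" where
  "diag_transitive_point T d x \<longleftrightarrow>
    power_space d closure_of diag_orbit T d x = topspace (power_space d)"

definition Delta_transitive :: "('a::topological_space \<Rightarrow> 'a) \<Rightarrow> bool" where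
  "Delta_transitive T \<longleftrightarrow>
    (\<forall>d\<ge>2. \<exists>X0. residual X0 \<and> (\<forall>x\<in>X0. diag_transitive_point T d x))"

text \<open>The sets \<open>U\<^sub>1, \<dots>, U\<^sub>d\<close> are the values of \<open>U\<close> on \<open>{1..d}\<close>.\<close>

definition hitting_times :: "('a \<Rightarrow> 'a) \<Rightarrow> nat \<Rightarrow> (nat \<Rightarrow> 'a set) \<Rightarrow> nat set" where
  "hitting_times T d U =
    {n. n \<ge> 1 \<and> (\<Inter>i\<in>{1..d}. (T ^^ ((i - 1) * n)) -` U i) \<noteq> {}}"

end

theory Submission
  imports Defs
begin

text \<open>If \<open>x\<close> is diagonally transitive and \<open>T\<close> is onto, approximating the nonempty open sets
  \<open>T\<^sup>-\<^sup>i U\<^sub>i\<close> instead of the \<open>U\<^sub>i\<close> yields an \<open>n \<ge> 0\<close> with \<open>T\<^bsup>i(n+1)\<^esup> x \<in> U\<^sub>i\<close>, so \<open>T\<^bsup>n+1\<^esup> x\<close>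
  witnesses a hitting time that is automatically positive. Conversely, applying the hitting
  condition to \<open>V, U\<^sub>1, \<dots>, U\<^sub>d\<close> shows that the points whose diagonal orbit meets
  \<open>U\<^sub>1 \<times> \<dots> \<times> U\<^sub>d\<close> form a dense open set; intersect over a countable family of \<open>U\<close>.\<close>

text \<open>Open boxes form a base of the finite product, so density only has to be tested on them.
  Later arguments about transitive points use this form and avoid the product topology.\<close>

lemma diag_transitive_point_iff:
  fixes T :: "'a::topological_space \<Rightarrow> 'a"
  shows
  "diag_transitive_point T d x \<longleftrightarrow>
    (\<forall>U. (\<forall>i\<in>{1..d}. open (U i) \<and> U i \<noteq> {}) \<longrightarrow> (\<exists>n. \<forall>i\<in>{1..d}. (T ^^ (i * n)) x \<in> U i))"
    (is "_ \<longleftrightarrow> (\<forall>U. ?open U \<longrightarrow> ?hit U)")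
proof -
  have hit_iff: "?hit U \<longleftrightarrow> diag_orbit T d x \<inter> Pi\<^sub>E {1..d} U \<noteq> {}" for U
  proof -
    have "diag_orbit T d x \<inter> Pi\<^sub>E {1..d} U \<noteq> {} \<longleftrightarrow>
        (\<exists>n. (\<lambda>i\<in>{1..d}. (T ^^ (i * n)) x) \<in> Pi\<^sub>E {1..d} U)"
      unfolding diag_orbit_def by blast
    then show ?thesis by (simp only: restrict_PiE_iff)
  qed
  have "?hit U" if "diag_transitive_point T d x" "?open U" for U
  proof -
    have "openin (power_space d) (Pi\<^sub>E {1..d} U)"
      using that by (simp add: openin_PiE_gen)
    moreover have "Pi\<^sub>E {1..d} U \<noteq> {}"
      using that by (simp add: PiE_eq_empty_iff)
    ultimately show ?thesis
      using that(1) unfolding hit_iff diag_transitive_point_def dense_intersects_open by blast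
  qed
  moreover have "diag_transitive_point T d x" if hit: "\<forall>U. ?open U \<longrightarrow> ?hit U"
    unfolding diag_transitive_point_def dense_intersects_open
  proof (intro allI impI)
    fix W :: "(nat \<Rightarrow> 'a) set" assume W: "openin (power_space d) W \<and> W \<noteq> {}"
    then obtain w where "w \<in> W" by blast
    \<comment> \<open>Every factor of the box contains the matching coordinate of \<open>w\<close>,
      so it is nonempty and \<open>hit\<close> applies.\<close>
    with W obtain U :: "nat \<Rightarrow> 'a set" where U: "\<And>i. i \<in> {1..d} \<Longrightarrow> open (U i)" "w \<in> Pi\<^sub>E {1..d} U"
        "Pi\<^sub>E {1..d} U \<subseteq> W"
      unfolding openin_product_topology_alt by (metis open_openin)
    then have "?hit U"
      using hit by blast
    then show "diag_orbit T d x \<inter> W \<noteq> {}"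
      using U(3) unfolding hit_iff by blast
  qed
  ultimately show ?thesis by blast
qed

lemma diag_transitive_pointE:
  fixes T :: "'a::topological_space \<Rightarrow> 'a"
  assumes "diag_transitive_point T d x" "\<forall>i\<in>{1..d}. open (U i) \<and> U i \<noteq> {}"
  obtains n where "\<forall>i\<in>{1..d}. (T ^^ (i * n)) x \<in> U i"
  using assms(1)[unfolded diag_transitive_point_iff, THEN spec, of U] assms(2) by iprover

text \<open>The missing coordinates are padded with the whole space, which imposes no constraint.
  This gives access to \<open>d = 1\<close>, which Delta-transitivity does not mention, and reduces
  surjectivity to two coordinates.\<close>

lemma diag_transitive_point_mono:
  fixes T :: "'a::topological_space \<Rightarrow> 'a"
  assumes "diag_transitive_point T d x" "e \<le> d"
  shows "diag_transitive_point T e x"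
  unfolding diag_transitive_point_iff
proof (intro allI impI)
  fix U :: "nat \<Rightarrow> 'a set" assume U: "\<forall>i\<in>{1..e}. open (U i) \<and> U i \<noteq> {}"
  let ?U = "\<lambda>i. if i \<le> e then U i else UNIV"
  have "\<forall>i\<in>{1..d}. open (?U i) \<and> ?U i \<noteq> {}"
    using U by simp
  with assms(1) obtain n where "\<forall>i\<in>{1..d}. (T ^^ (i * n)) x \<in> ?U i"
    by (rule diag_transitive_pointE)
  then show "\<exists>n. \<forall>i\<in>{1..e}. (T ^^ (i * n)) x \<in> U i"
    using assms(2) by (intro exI[of _ n]) force
qed

lemma continuous_on_funpow:
  fixes T :: "'a::topological_space \<Rightarrow> 'a"
  assumes "continuous_on UNIV T"
  shows "continuous_on UNIV (T ^^ n)"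
proof (induction n)
  case (Suc n)
  then show ?case
    using continuous_on_compose[of UNIV "T ^^ n" T] continuous_on_subset[OF assms] by simp
qed (simp add: id_def)

text \<open>Total boundedness gives a finite net for each radius \<open>1 / Suc n\<close>; the balls
  around all net points form the family. Density arguments only need a member inside each nonempty
  open set, so a full base is not constructed.\<close>

lemma compact_UNIV_countable_pi_base:
  assumes "compact (UNIV :: ('a::metric_space) set)"
  obtains B :: "'a::metric_space set set" where "countable B" "\<And>U. U \<in> B \<Longrightarrow> open U \<and> U \<noteq> {}"
    "\<And>U. open U \<Longrightarrow> U \<noteq> {} \<Longrightarrow> \<exists>V\<in>B. V \<subseteq> U"
proof -
  have "\<forall>n. \<exists>K :: 'a set. finite K \<and> UNIV \<subseteq> (\<Union>x\<in>K. ball x (1 / Suc n))"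
    using assms unfolding compact_eq_totally_bounded by simp
  then obtain K :: "nat \<Rightarrow> 'a set" where
    K: "\<And>n. finite (K n)" "\<And>n. UNIV \<subseteq> (\<Union>x\<in>K n. ball x (1 / Suc n))"
    by (auto dest!: choice)
  define B where "B = (\<Union>n. (\<lambda>x. ball x (1 / Suc n)) ` K n)"
  show thesis
  proof
    show "countable B"
      unfolding B_def by (intro countable_UN countableI_type countable_image countable_finite K)
    show "open U \<and> U \<noteq> {}" if "U \<in> B" for U
      using that by (auto simp: B_def)
    fix U :: "'a set" assume "open U" "U \<noteq> {}"
    then obtain x e where x: "e > 0" "ball x e \<subseteq> U"
      by (metis ex_in_conv open_contains_ball)
    \<comment> \<open>Half of \<open>e\<close> pays for the distance from \<open>x\<close> to the
      net point, the other half for the radius of its ball.\<close>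
    obtain n where n: "1 / Suc n < e / 2"
      using x(1) nat_approx_posE[of "e / 2"] by auto
    obtain y where y: "y \<in> K n" "dist y x < 1 / Suc n"
      using K(2)[of n] by (auto simp: subset_iff)
    have "ball y (1 / Suc n) \<subseteq> ball x e"
    proof
      fix z assume "z \<in> ball y (1 / Suc n)"
      then show "z \<in> ball x e"
        using y n dist_triangle[of x z y] by (simp add: dist_commute)
    qed
    then show "\<exists>V\<in>B. V \<subseteq> U"
      using x(2) y(1) unfolding B_def by blast
  qed
qed

text \<open>A compact metric space is locally compact and regular, so by Baire's theorem the
  intersection of countably many dense open sets is dense. The empty set is not dense because a type
  is inhabited.\<close>

lemma residual_nonempty:
  fixes A :: "'a::metric_space set"
  assumes "compact (UNIV :: 'a set)" "residual A"
  shows "A \<noteq> {}"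
proof -
  obtain \<G> where \<G>: "countable \<G>" "\<forall>G\<in>\<G>. open G \<and> closure G = UNIV" "\<Inter>\<G> \<subseteq> A"
    using assms(2) unfolding residual_def by blast
  have "compact_space (euclidean :: 'a topology)"
    using assms(1) by (simp add: compact_space_def)
  then have "locally_compact_space (euclidean :: 'a topology)"
    by (rule compact_imp_locally_compact_space)
  moreover have "regular_space (euclidean :: 'a topology)"
    using metrizable_imp_regular_space metrizable_space_euclidean by blast
  ultimately have "euclidean closure_of \<Inter>\<G> = topspace euclidean"
    using \<G> by (intro Baire_category) auto
  then show ?thesis
    using \<G>(3) by auto
qed

text \<open>The range is compact, hence closed, so a missed point makes its complement a nonempty
  open set. An iterate of \<open>x\<close> can lie there only at time 0, when the second coordinate
  is \<open>x\<close> itself; asking that coordinate to avoid \<open>x\<close> is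
  contradictory.\<close>

lemma surj_if_diag_transitive_point:
  fixes T :: "'a::t2_space \<Rightarrow> 'a"
  assumes "compact (UNIV :: 'a set)" "continuous_on UNIV T"
    and x: "diag_transitive_point T d x" "d \<ge> 2"
  shows "surj T"
proof (rule ccontr)
  assume "\<not> surj T"
  then obtain y where y: "y \<notin> range T" by blast
  have x2: "diag_transitive_point T 2 x"
    using x by (rule diag_transitive_point_mono)
  let ?U = "\<lambda>i::nat. if i = 1 then - range T else - {x}"
  have "closed (range T)"
    using assms by (simp add: compact_continuous_image compact_imp_closed)
  \<comment> \<open>The point \<open>y\<close> differs from \<open>x\<close>, or else
    \<open>T x\<close> does, since \<open>y\<close> is outside the range.\<close>
  moreover have "- {x} \<noteq> {}"
    using y by (cases "x = y") (auto simp: set_eq_iff)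
  ultimately have "\<forall>i\<in>{1..2}. open (?U i) \<and> ?U i \<noteq> {}"
    using y by auto
  with x2 obtain n where n: "\<forall>i\<in>{1..2}. (T ^^ (i * n)) x \<in> ?U i"
    by (rule diag_transitive_pointE)
  then have "(T ^^ n) x \<notin> range T" "(T ^^ (2 * n)) x \<noteq> x"
    by (auto dest: bspec[where x = 1] bspec[where x = 2])
  then show False
    by (cases n) auto
qed

lemma hitting_times_nonempty_if_diag_transitive_point:
  fixes T :: "'a::topological_space \<Rightarrow> 'a"
  assumes "continuous_on UNIV T" "surj T" and x: "diag_transitive_point T d x"
    and U: "\<forall>i\<in>{1..d}. open (U i) \<and> U i \<noteq> {}"
  shows "hitting_times T d U \<noteq> {}"
proof -
  have "open ((T ^^ i) -` U i) \<and> (T ^^ i) -` U i \<noteq> {}" if "i \<in> {1..d}" for i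
  proof -
    have "surj (T ^^ i)"
      using assms(2) by simp
    then show ?thesis
      using U that continuous_on_funpow[OF assms(1), of i]
      by (metis open_vimage image_vimage_eq image_empty inf_top_right)
  qed
  then have "\<forall>i\<in>{1..d}. open ((T ^^ i) -` U i) \<and> (T ^^ i) -` U i \<noteq> {}"
    by blast
  with x obtain n where n: "\<forall>i\<in>{1..d}. (T ^^ (i * n)) x \<in> (T ^^ i) -` U i"
    by (rule diag_transitive_pointE)
  \<comment> \<open>Starting from \<open>(T ^^ Suc n) x\<close> supplies the one multiple of
    \<open>Suc n\<close> that the exponent \<open>(i - 1) * Suc n\<close> lacks. The subtraction is
    not truncated, as \<open>i\<close> is at least 1.\<close>
  have "(T ^^ ((i - 1) * Suc n)) ((T ^^ Suc n) x) \<in> U i" if i: "i \<in> {1..d}" for i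
  proof -
    have "(i - 1) * Suc n + Suc n = i + i * n"
      using i by (cases i) auto
    then have "(T ^^ ((i - 1) * Suc n)) ((T ^^ Suc n) x) = (T ^^ i) ((T ^^ (i * n)) x)"
      by (metis funpow_add comp_apply)
    then show ?thesis using n i by simp
  qed
  then have "(T ^^ Suc n) x \<in> (\<Inter>i\<in>{1..d}. (T ^^ ((i - 1) * Suc n)) -` U i)"
    by blast
  then have "Suc n \<in> hitting_times T d U"
    unfolding hitting_times_def using le_add1[of 1 n] by (simp only: mem_Collect_eq plus_1_eq_Suc) blast
  then show ?thesis by blast
qed

lemma closure_UNIV_if_hitting_times_nonempty:
  assumes hit: "\<And>U. \<forall>i\<in>{1..Suc d}. open (U i) \<and> U i \<noteq> {} \<Longrightarrow> hitting_times T (Suc d) U \<noteq> {}"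
    and U: "\<forall>i\<in>{1..d}. open (U i) \<and> U i \<noteq> {}"
  shows "closure (\<Union>n. \<Inter>i\<in>{1..d}. (T ^^ (i * n)) -` U i) = UNIV" (is "closure ?G = _")
proof -
  have "?G \<inter> V \<noteq> {}" if V: "open V" "V \<noteq> {}" for V
  proof -
    \<comment> \<open>Slot 1 has exponent 0, so the witness itself lies in \<open>V\<close>; moving
      \<open>U i\<close> to slot \<open>i + 1\<close> gives it the exponent
      \<open>i * n\<close>.\<close>
    let ?U = "\<lambda>i. if i = 1 then V else U (i - 1)"
    have "hitting_times T (Suc d) ?U \<noteq> {}"
    proof (intro hit ballI)
      fix i assume "i \<in> {1..Suc d}"
      then have "i = 1 \<or> i - 1 \<in> {1..d}" by auto
      then show "open (?U i) \<and> ?U i \<noteq> {}"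
        using U V by auto
    qed
    then obtain n y where y: "\<And>i. i \<in> {1..Suc d} \<Longrightarrow> (T ^^ ((i - 1) * n)) y \<in> ?U i"
      unfolding hitting_times_def by blast
    have "(T ^^ (i * n)) y \<in> U i" if "i \<in> {1..d}" for i
      using y[of "Suc i"] that by auto
    moreover have "y \<in> V"
      using y[of 1] by simp
    ultimately show ?thesis by blast
  qed
  then have "euclidean closure_of ?G = topspace euclidean"
    unfolding dense_intersects_open open_openin[symmetric] by iprover
  then show ?thesis by simp
qed

lemma residual_diag_transitive_points:
  fixes T :: "'a::metric_space \<Rightarrow> 'a"
  assumes "compact (UNIV :: 'a set)" "continuous_on UNIV T"
    and hit: "\<And>U. \<forall>i\<in>{1..Suc d}. open (U i) \<and> U i \<noteq> {} \<Longrightarrow> hitting_times T (Suc d) U \<noteq> {}"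
  shows "residual {x. diag_transitive_point T d x}"
proof -
  obtain B :: "'a set set" where B: "countable B" "\<And>U. U \<in> B \<Longrightarrow> open U \<and> U \<noteq> {}"
    "\<And>U. open U \<Longrightarrow> U \<noteq> {} \<Longrightarrow> \<exists>V\<in>B. V \<subseteq> U"
    using compact_UNIV_countable_pi_base[OF assms(1)] by blast
  define G where "G U = (\<Union>n. \<Inter>i\<in>{1..d}. (T ^^ (i * n)) -` U i)" for U
  \<comment> \<open>Extensional functions from a finite index set into a countable set are countably
    many, hence so are the sets \<open>G U\<close>.\<close>
  have "countable (G ` ({1..d} \<rightarrow>\<^sub>E B))"
    using B(1) by (intro countable_image countable_PiE) auto
  moreover have "\<forall>H \<in> G ` ({1..d} \<rightarrow>\<^sub>E B). open H \<and> closure H = UNIV"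
  proof (intro ballI, elim imageE, intro conjI, simp_all only:)
    fix U assume U: "U \<in> {1..d} \<rightarrow>\<^sub>E B"
    have U': "\<forall>i\<in>{1..d}. open (U i) \<and> U i \<noteq> {}"
      using U B(2) by (simp add: PiE_iff)
    then show "open (G U)"
      unfolding G_def using continuous_on_funpow[OF assms(2)]
      by (intro open_UN open_INT ballI open_vimage) auto
    show "closure (G U) = UNIV"
      unfolding G_def by (rule closure_UNIV_if_hitting_times_nonempty[OF hit U'])
  qed
  moreover have "\<Inter>(G ` ({1..d} \<rightarrow>\<^sub>E B)) \<subseteq> {x. diag_transitive_point T d x}"
    unfolding diag_transitive_point_iff
  proof (intro subsetI CollectI allI impI)
    fix x and U :: "nat \<Rightarrow> 'a set"
    assume x: "x \<in> \<Inter>(G ` ({1..d} \<rightarrow>\<^sub>E B))"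
    assume "\<forall>i\<in>{1..d}. open (U i) \<and> U i \<noteq> {}"
    then have "\<forall>i\<in>{1..d}. \<exists>V\<in>B. V \<subseteq> U i"
      using B(3) by blast
    then obtain V where V: "\<And>i. i \<in> {1..d} \<Longrightarrow> V i \<in> B \<and> V i \<subseteq> U i"
      by (meson bchoice)
    \<comment> \<open>The choice function \<open>V\<close> is arbitrary outside
      \<open>{1..d}\<close>; restricting it yields an index of the family.\<close>
    then have "x \<in> G (restrict V {1..d})"
      using x by (simp add: restrict_PiE_iff)
    then obtain n where "\<forall>i\<in>{1..d}. (T ^^ (i * n)) x \<in> V i"
      unfolding G_def by auto
    then show "\<exists>n. \<forall>i\<in>{1..d}. (T ^^ (i * n)) x \<in> U i"
      using V by blast
  qed
  ultimately show ?thesis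
    unfolding residual_def by (intro exI conjI)
qed

theorem proposition3p1:
  fixes T :: "'a::metric_space \<Rightarrow> 'a"
  assumes "dynamical_system T"
  shows "(Delta_transitive T \<longleftrightarrow>
            surj T \<and> (\<forall>d\<ge>1. \<exists>x. diag_transitive_point T d x)) \<and>
         (Delta_transitive T \<longleftrightarrow>
            (\<forall>d\<ge>2. \<forall>U. (\<forall>i\<in>{1..d}. open (U i) \<and> U i \<noteq> {}) \<longrightarrow>
               hitting_times T d U \<noteq> {}))"
    (is "(?D \<longleftrightarrow> ?P) \<and> (?D \<longleftrightarrow> ?H)")
proof -
  have cpt: "compact (UNIV :: 'a set)" and cont: "continuous_on UNIV T"
    using assms by (auto simp: dynamical_system_def)
  \<comment> \<open>The equivalences follow from the cycle \<open>?D\<close> to \<open>?P\<close> to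
    \<open>?H\<close> to \<open>?D\<close>.\<close>
  have "?P" if ?D
  proof -
    have ex: "\<exists>x. diag_transitive_point T d x" if "d \<ge> 2" for d
      using \<open>?D\<close> that residual_nonempty[OF cpt] unfolding Delta_transitive_def by blast
    then have "surj T"
      using surj_if_diag_transitive_point[OF cpt cont] by blast
    \<comment> \<open>For \<open>d\<close> below 2 a transitive point for two coordinates is
      projected down.\<close>
    moreover have "\<exists>x. diag_transitive_point T d x" for d
      using ex[of "max d 2"] diag_transitive_point_mono[of T "max d 2" _ d] by auto
    ultimately show ?thesis by blast
  qed
  moreover have "?H" if ?P
  proof (intro allI impI)
    fix d :: nat and U :: "nat \<Rightarrow> 'a set"
    assume d: "d \<ge> 2" and U: "\<forall>i\<in>{1..d}. open (U i) \<and> U i \<noteq> {}"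
    obtain x where "diag_transitive_point T d x"
      using \<open>?P\<close> d by force
    then show "hitting_times T d U \<noteq> {}"
      using \<open>?P\<close> U by (intro hitting_times_nonempty_if_diag_transitive_point[OF cont]) auto
  qed
  moreover have "?D" if ?H
    unfolding Delta_transitive_def
  proof (intro allI impI)
    fix d :: nat assume "d \<ge> 2"
    \<comment> \<open>Here \<open>?H\<close> is applied to \<open>Suc d\<close> sets, the extra one
      being the set tested for density.\<close>
    then have "residual {x. diag_transitive_point T d x}"
      using \<open>?H\<close> by (intro residual_diag_transitive_points[OF cpt cont]) simp
    then show "\<exists>X0. residual X0 \<and> (\<forall>x\<in>X0. diag_transitive_point T d x)"
      by blast
  qed
  ultimately show ?thesis by blast
qed

end
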